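(* Let $r\in\mathbb{N}$, let $\overrightarrow{\mathscr{P}}=(p_1,\dots,p_r)$ with $1\le p_1\le p_2\le\dots\le p_r<\infty$, and let $f\in L^{\overrightarrow{\mathscr{P}}}([-1,1]^r)$. Then for every $n\in\mathbb{N}$, $$\|K_nf\|_{\overrightarrow{\mathscr{P}}}\le\left(\frac{\|\Psi_\rho\|_{1}}{\Psi_\rho(2)}\right)^{\sum_{i=1}^{r}\frac1{p_i}}\|f\|_{\overrightarrow{\mathscr{P}}},$$ where $\|\Psi_\rho\|_1$ is the $L^1(\mathbb{R})$-norm of the univariate density function $\Psi_\rho$.
   Context: Write $\mathcal{J}=[-1,1]^r$. Mixed norm Lebesgue space: for $\overrightarrow{\mathscr{P}}=(p_1,\dots,p_r)\in[1,\infty)^r$ and measurable $f:\mathcal{J}\to\mathbb{R}$, $$\|f\|_{\overrightarrow{\mathscr{P}}}=\left(\int_{-1}^{1}\cdots\left(\int_{-1}^{1}\left(\int_{-1}^{1}|f(x_1,\dots,x_r)|^{p_1}dx_1\right)^{\frac{p_2}{p_1}}dx_2\right)^{\frac{p_3}{p_2}}\cdots dx_r\right)^{\frac1{p_r}},$$ and $L^{\overrightarrow{\mathscr{P}}}(\mathcal{J})$ is the set of measurable $f$ with $\|f\|_{\overrightarrow{\mathscr{P}}}<\infty$. Activation function: $\rho:\mathbb{R}\to\mathbb{R}$ is a fixed non-decreasing sigmoidal function, i.e. $\lim_{x\to-\infty}\rho(x)=0$ and $\lim_{x\to\infty}\rho(x)=1$. Its univariate density function is $\Psi_\rho(x)=\frac12\big(\rho(x+1)-\rho(x-1)\big)$,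 $x\in\mathbb{R}$, and its multivariate density function is $\Psi_\rho(\mathbf{x})=\Psi_\rho(x_1)\cdots\Psi_\rho(x_r)$ for $\mathbf{x}=(x_1,\dots,x_r)\in\mathbb{R}^r$. Standing assumptions on $\Psi_\rho$: $\Psi_\rho(x)=\mathcal{O}(|x|^{-\eta})$ as $x\to\pm\infty$ for some $\eta>1$; $\int_{\mathbb{R}}\Psi_\rho(t)\,dt=1$; $\sum_{k\in\mathbb{Z}}\Psi_\rho(x-k)=1$ for every $x\in\mathbb{R}$, the series converging uniformly on compact sets; and, for all $n\in\mathbb{N}$ and $x\in[-1,1]$, $\sum_{k=-n}^{n-1}\Psi_\rho(nx-k)\ge\Psi_\rho(2)>0$. Multivariate Kantorovich-type neural network operators: for integrable $f:\mathcal{J}\to\mathbb{R}$, $n\in\mathbb{N}$ and $\mathbf{x}\in\mathcal{J}$, $$K_nf(\mathbf{x})=K_n(f,\mathbf{x})=\frac{\sum_{\mathbf{k}\in\{-n,\dots,n-1\}^r}\left(n^r\int_{I_{\mathbf{k},n}}f(\mathbf{t})\,d\mathbf{t}\right)\Psi_\rho(n\mathbf{x}-\mathbf{k})}{\sum_{\mathbf{k}\in\{-n,\dots,n-1\}^r}\Psi_\rho(n\mathbf{x}-\mathbf{k})},\qquad I_{\mathbf{k},n}=\prod_{j=1}^{r}\left[\frac{k_j}{n},\frac{k_j+1}{n}\right].$$ *)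

theory Defs
  imports "HOL-Analysis.Analysis" "HOL-Library.Landau_Symbols"
begin

text \<open>
  The dimension \<open>r\<close> is a term, since the mixed norm is defined by recursion over the coordinates.
  A point of \<open>r\<close>-dimensional space is a function in \<open>{1..r} \<rightarrow>\<^sub>E UNIV\<close>, and
  \<open>leb r\<close> is \<open>r\<close>-dimensional Lebesgue measure.
\<close>

definition leb :: "nat \<Rightarrow> (nat \<Rightarrow> real) measure" where
  "leb r = completion (\<Pi>\<^sub>M i\<in>{1..r}. lborel)"

definition cube :: "nat \<Rightarrow> (nat \<Rightarrow> real) set" where
  "cube r = ({1..r} \<rightarrow>\<^sub>E {-1..1})"

text \<open>Meant for exponents \<open>a > 0\<close>, for which \<open>\<infinity>\<close> raised to \<open>a\<close> is \<open>\<infinity>\<close>.\<close>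

definition ennpowr :: "ennreal \<Rightarrow> real \<Rightarrow> ennreal" where
  "ennpowr y a = (if y = \<infinity> then \<infinity> else ennreal (enn2real y powr a))"

text \<open>
  \<open>mixed_int p f k x\<close> is the innermost \<open>k\<close>-fold iterated integral in the mixed norm, with
  \<open>x\<^sub>1, \<dots>, x\<^sub>k\<close> integrated out (and overwritten in \<open>x\<close>), as a function of the remaining
  coordinates. For a Lebesgue measurable \<open>f\<close> the inner integrands are measurable for almost all
  values of the remaining coordinates; the exceptional null sets do not affect the final value.
\<close>

fun mixed_int :: "(nat \<Rightarrow> real) \<Rightarrow> ((nat \<Rightarrow> real) \<Rightarrow> real) \<Rightarrow> nat \<Rightarrow> (nat \<Rightarrow> real) \<Rightarrow> ennreal" where
  "mixed_int p f 0 x = ennreal \<bar>f x\<bar>"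
| "mixed_int p f (Suc 0) x =
     (\<integral>\<^sup>+ t\<in>{-1..1}. ennreal (\<bar>f (x(1 := t))\<bar> powr p 1) \<partial>lebesgue)"
| "mixed_int p f (Suc (Suc k)) x =
     (\<integral>\<^sup>+ t\<in>{-1..1}. ennpowr (mixed_int p f (Suc k) (x(Suc (Suc k) := t)))
        (p (Suc (Suc k)) / p (Suc k)) \<partial>lebesgue)"

text \<open>
  The base point \<open>\<lambda>_. undefined\<close> supplies the value that elements of \<open>cube r\<close> take outside
  \<open>{1..r}\<close>; its coordinates in \<open>{1..r}\<close> are all integrated out.
\<close>

definition mixed_norm :: "nat \<Rightarrow> (nat \<Rightarrow> real) \<Rightarrow> ((nat \<Rightarrow> real) \<Rightarrow> real) \<Rightarrow> ennreal" where
  "mixed_norm r p f = ennpowr (mixed_int p f r (\<lambda>_. undefined)) (1 / p r)"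

definition mixed_Lebesgue :: "nat \<Rightarrow> (nat \<Rightarrow> real) \<Rightarrow> ((nat \<Rightarrow> real) \<Rightarrow> real) set" where
  "mixed_Lebesgue r p =
     {f. f \<in> borel_measurable (restrict_space (leb r) (cube r)) \<and> mixed_norm r p f < \<infinity>}"

definition sigmoidal :: "(real \<Rightarrow> real) \<Rightarrow> bool" where
  "sigmoidal \<rho> \<longleftrightarrow> (\<rho> \<longlongrightarrow> 0) at_bot \<and> (\<rho> \<longlongrightarrow> 1) at_top"

definition psi :: "(real \<Rightarrow> real) \<Rightarrow> real \<Rightarrow> real" where
  "psi \<rho> x = (\<rho> (x + 1) - \<rho> (x - 1)) / 2"

definition psi_multi :: "nat \<Rightarrow> (real \<Rightarrow> real) \<Rightarrow> (nat \<Rightarrow> real) \<Rightarrow> real" where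
  "psi_multi r \<rho> x = (\<Prod>i\<in>{1..r}. psi \<rho> (x i))"

definition kant_index :: "nat \<Rightarrow> nat \<Rightarrow> (nat \<Rightarrow> int) set" where
  "kant_index r n = ({1..r} \<rightarrow>\<^sub>E {- int n..int n - 1})"

definition kant_box :: "nat \<Rightarrow> nat \<Rightarrow> (nat \<Rightarrow> int) \<Rightarrow> (nat \<Rightarrow> real) set" where
  "kant_box r n k = (\<Pi>\<^sub>E j\<in>{1..r}. {real_of_int (k j) / real n..(real_of_int (k j) + 1) / real n})"

definition kantorovich ::
    "nat \<Rightarrow> (real \<Rightarrow> real) \<Rightarrow> nat \<Rightarrow> ((nat \<Rightarrow> real) \<Rightarrow> real) \<Rightarrow> (nat \<Rightarrow> real) \<Rightarrow> real" where
  "kantorovich r \<rho> n f x =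
     (\<Sum>k\<in>kant_index r n. (real n ^ r * (LINT t:kant_box r n k|leb r. f t)) *
        psi_multi r \<rho> (\<lambda>j. real n * x j - real_of_int (k j))) /
     (\<Sum>k\<in>kant_index r n. psi_multi r \<rho> (\<lambda>j. real n * x j - real_of_int (k j)))"

text \<open>The sum over all integers is the unordered sum, the limit over the filter of finite subsets.\<close>

definition psi_assms :: "(real \<Rightarrow> real) \<Rightarrow> bool" where
  "psi_assms \<rho> \<longleftrightarrow>
     (\<exists>\<eta>>1. psi \<rho> \<in> O[at_top](\<lambda>x. \<bar>x\<bar> powr (- \<eta>)) \<and> psi \<rho> \<in> O[at_bot](\<lambda>x. \<bar>x\<bar> powr (- \<eta>))) \<and>
     has_bochner_integral lborel (psi \<rho>) 1 \<and>
     (\<forall>x. ((\<lambda>k::int. psi \<rho> (x - real_of_int k)) has_sum 1) UNIV) \<and>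
     (\<forall>C. compact C \<longrightarrow>
        uniform_limit C (\<lambda>F x. \<Sum>k\<in>F. psi \<rho> (x - real_of_int k)) (\<lambda>_. 1)
          (finite_subsets_at_top (UNIV :: int set))) \<and>
     psi \<rho> 2 > 0 \<and>
     (\<forall>n\<ge>1. \<forall>x\<in>{-1..1}.
        (\<Sum>k\<in>{- int n..int n - 1}. psi \<rho> (real n * x - real_of_int k)) \<ge> psi \<rho> 2)"

definition L1_norm :: "(real \<Rightarrow> real) \<Rightarrow> real" where
  "L1_norm g = (LINT t|lborel. \<bar>g t\<bar>)"

end

theory Submission
  imports Defs
begin

text \<open>
  The denominator of \<open>K\<^sub>n\<close> factors over the coordinates, so \<open>\<bar>K\<^sub>n f\<bar>\<close> is at most the average of \<open>\<bar>f\<bar>\<close>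
  against a tensor product of univariate kernels \<open>\<kappa>\<close> with \<open>\<integral> \<kappa>(s, t) dt = 1\<close> and
  \<open>\<integral> \<kappa>(s, t) ds \<le> C\<close>, where \<open>C = 1 / \<Psi>(2)\<close> and the second integral is over \<open>[-1, 1]\<close>.
  The iterated integrals of the mixed norm are then estimated one coordinate at a time: the
  exponent \<open>p\<^sub>k\<^sub>+\<^sub>1 / p\<^sub>k \<ge> 1\<close> moves inside the remaining averages by Jensen's inequality, and
  integrating out \<open>x\<^sub>k\<^sub>+\<^sub>1\<close> removes the kernel in that coordinate at the cost of a factor \<open>C\<close>.
\<close>

section \<open>Powers of extended nonnegative reals and Jensen's inequality\<close>

lemma ennpowr_mono: "ennpowr y a \<le> ennpowr z a" if "y \<le> z" "0 \<le> a"
proof (cases "z = \<infinity>")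
  case False
  with that have "y < \<infinity>" "z < \<infinity>"
    by (auto simp: top.not_eq_extremum intro: le_less_trans)
  then show ?thesis
    using that by (auto simp: ennpowr_def intro!: ennreal_leI powr_mono2 enn2real_mono)
qed (simp add: ennpowr_def)

lemma ennpowr_ennreal: "ennpowr (ennreal y) a = ennreal (y powr a)" if "0 \<le> y"
  using that by (simp add: ennpowr_def)

lemma ennpowr_cmult:
  assumes "0 < c" "0 < a"
  shows "ennpowr (ennreal c * y) a = ennreal (c powr a) * ennpowr y a"
proof (cases y)
  case (real z)
  with assms show ?thesis
    by (simp add: ennpowr_ennreal powr_mult flip: ennreal_mult)
next
  case top
  with assms show ?thesis
    by (simp add: ennpowr_def ennreal_mult_top)
qed

lemma measurable_ennpowr [measurable (raw)]:
  assumes [measurable]: "f \<in> borel_measurable M"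
  shows "(\<lambda>x. ennpowr (f x) a) \<in> borel_measurable M"
  unfolding ennpowr_def by measurable

text \<open>Weighted AM-GM for \<open>h powr q\<close> and \<open>a powr q\<close> with weights
  \<open>1 / q\<close> and \<open>1 - 1 / q\<close>. It is the tangent line bound for
  \<open>z powr q\<close> at \<open>a\<close>, with the negative term moved to the right so that it
  carries over to \<open>ennreal\<close>.\<close>

lemma Young_powr:
  fixes a h q :: real
  assumes "0 < a" "0 \<le> h" "1 \<le> q"
  shows "q * a powr (q - 1) * h \<le> h powr q + (q - 1) * a powr q"
proof (cases "h = 0")
  case False
  have "(h powr q) powr (1 / q) * (a powr q) powr (1 - 1 / q)
      \<le> (1 / q) * h powr q + (1 - 1 / q) * a powr q"
    using assms False by (intro Youngs_inequality_0) auto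
  moreover have "(h powr q) powr (1 / q) = h" "(a powr q) powr (1 - 1 / q) = a powr (q - 1)"
    using assms False by (auto simp: powr_powr algebra_simps)
  ultimately have "q * (h * a powr (q - 1)) \<le> q * ((1 / q) * h powr q + (1 - 1 / q) * a powr q)"
    using assms by (intro mult_left_mono) auto
  then show ?thesis
    using assms by (simp add: algebra_simps)
qed (use assms in auto)

lemma ennpowr_nn_integral_le:
  assumes [measurable]: "K \<in> borel_measurable M" "h \<in> borel_measurable M"
    and mass: "(\<integral>\<^sup>+ y. K y \<partial>M) \<le> 1" and q: "1 \<le> q"
  shows "ennpowr (\<integral>\<^sup>+ y. K y * h y \<partial>M) q \<le> (\<integral>\<^sup>+ y. K y * ennpowr (h y) q \<partial>M)"
  \<comment> \<open>Integrate the tangent line inequality for \<open>z powr q\<close> at the point \<open>a = \<integral> K h\<close>.\<close>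
proof (cases "\<integral>\<^sup>+ y. K y * h y \<partial>M")
  case top
  \<comment> \<open>There is no tangent at an infinite point. Integrating
    \<open>z \<le> 1 + z powr q\<close> instead shows that the right side is infinite too, since the
    summand 1 contributes at most the mass.\<close>
  have "h y \<le> 1 + ennpowr (h y) q" for y
  proof (cases "h y")
    case (real z)
    have "z \<le> 1 + z powr q"
      using real q powr_mono[of 1 q z] by (cases "z \<le> 1") (auto simp: add_increasing2 intro: order_trans)
    with real show ?thesis
      by (simp add: ennpowr_ennreal flip: ennreal_1 ennreal_plus)
  qed (simp add: ennpowr_def)
  then have "(\<integral>\<^sup>+ y. K y * h y \<partial>M) \<le> (\<integral>\<^sup>+ y. K y * (1 + ennpowr (h y) q) \<partial>M)"
    by (intro nn_integral_mono mult_left_mono) auto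
  also have "\<dots> = (\<integral>\<^sup>+ y. K y \<partial>M) + (\<integral>\<^sup>+ y. K y * ennpowr (h y) q \<partial>M)"
    by (simp add: distrib_left nn_integral_add)
  finally have "(\<integral>\<^sup>+ y. K y * ennpowr (h y) q \<partial>M) = \<infinity>"
    using top mass by (auto simp: top_unique ennreal_add_eq_top)
  then show ?thesis by simp
next
  case (real a)
  show ?thesis
  proof (cases "a = 0")
    case True
    then show ?thesis using real by (simp add: ennpowr_def)
  next
    case False
    with real have a: "0 < a" by simp
    have young: "ennreal (q * a powr (q - 1)) * h y
        \<le> ennpowr (h y) q + ennreal ((q - 1) * a powr q)" for y
    proof (cases "h y")
      case (real z)
      then show ?thesis
        using Young_powr[OF a, of z q] q a
        by (simp add: ennpowr_ennreal flip: ennreal_mult ennreal_plus)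
    qed (simp add: ennpowr_def)
    \<comment> \<open>The surplus \<open>(q - 1) * a powr q\<close> is finite and is cancelled at
      the end; the mass bound ensures that at most one copy of it appears on the right.\<close>
    have "ennreal (a powr q) + ennreal ((q - 1) * a powr q) = ennreal (q * a powr (q - 1) * a)"
      using a q by (simp add: algebra_simps powr_diff flip: ennreal_plus)
    also have "\<dots> = ennreal (q * a powr (q - 1)) * (\<integral>\<^sup>+ y. K y * h y \<partial>M)"
      using a q by (simp add: real ennreal_mult)
    also have "\<dots> = (\<integral>\<^sup>+ y. K y * (ennreal (q * a powr (q - 1)) * h y) \<partial>M)"
      by (subst nn_integral_cmult[symmetric]) (auto simp: ac_simps)
    also have "\<dots> \<le> (\<integral>\<^sup>+ y. K y * (ennpowr (h y) q + ennreal ((q - 1) * a powr q)) \<partial>M)"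
      by (intro nn_integral_mono mult_left_mono young) auto
    also have "\<dots> = (\<integral>\<^sup>+ y. K y * ennpowr (h y) q \<partial>M)
        + (\<integral>\<^sup>+ y. K y \<partial>M) * ennreal ((q - 1) * a powr q)"
      by (simp add: distrib_left nn_integral_add nn_integral_multc)
    also have "\<dots> \<le> (\<integral>\<^sup>+ y. K y * ennpowr (h y) q \<partial>M) + ennreal ((q - 1) * a powr q)"
      using mult_right_mono[OF mass] by (intro add_left_mono) auto
    finally show ?thesis
      using a real by (simp add: ennpowr_ennreal ennreal_add_left_cancel_le add.commute[of _ "ennreal ((q - 1) * a powr q)"])
  qed
qed

section \<open>Product spaces and iterated integrals of nonnegative functions\<close>

abbreviation prod_lborel :: "nat set \<Rightarrow> (nat \<Rightarrow> real) measure" where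
  "prod_lborel I \<equiv> (\<Pi>\<^sub>M i\<in>I. lborel)"

interpretation prod_lborel: product_sigma_finite "\<lambda>_ :: nat. lborel :: real measure"
  by unfold_locales

text \<open>Coordinates up to \<open>k\<close> are held fixed while the later ones are averaged
  over. The restriction to \<open>{1..r}\<close> makes the result extensional, as points of the
  product space must be.\<close>

definition override :: "nat \<Rightarrow> nat \<Rightarrow> (nat \<Rightarrow> real) \<Rightarrow> (nat \<Rightarrow> real) \<Rightarrow> nat \<Rightarrow> real" where
  "override r k x y = (\<lambda>i\<in>{1..r}. if i \<le> k then x i else y i)"

lemma measurable_override [measurable (raw)]:
  assumes f: "f \<in> M \<rightarrow>\<^sub>M prod_lborel {1..r}" and g: "g \<in> M \<rightarrow>\<^sub>M prod_lborel {Suc k..r}"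
  shows "(\<lambda>w. override r k (f w) (g w)) \<in> M \<rightarrow>\<^sub>M prod_lborel {1..r}"
  unfolding override_def
proof (rule measurable_restrict)
  fix i assume i: "i \<in> {1..r}"
  show "(\<lambda>w. if i \<le> k then f w i else g w i) \<in> M \<rightarrow>\<^sub>M lborel"
  proof (cases "i \<le> k")
    case True
    with measurable_compose[OF f measurable_component_singleton[OF i]] show ?thesis by simp
  next
    case False
    with i have "i \<in> {Suc k..r}" by simp
    from measurable_compose[OF g measurable_component_singleton[OF this]] False show ?thesis by simp
  qed
qed

lemma measurable_coordinate_update [measurable (raw)]:
  assumes "f \<in> M \<rightarrow>\<^sub>M prod_lborel {1..r}" "g \<in> borel_measurable M" "i \<in> {1..r}"
  shows "(\<lambda>w. (f w)(i := g w)) \<in> M \<rightarrow>\<^sub>M prod_lborel {1..r}"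
  using assms by (intro measurable_fun_upd[where J="{1..r}"]) auto

text \<open>
  With \<open>p 0 = 1\<close> this is \<open>mixed_int\<close> for \<open>ennreal\<close>-valued functions, without the special case for
  the innermost integral.
\<close>

fun mixed_nn_int ::
    "(nat \<Rightarrow> real) \<Rightarrow> ((nat \<Rightarrow> real) \<Rightarrow> ennreal) \<Rightarrow> nat \<Rightarrow> (nat \<Rightarrow> real) \<Rightarrow> ennreal" where
  "mixed_nn_int p h 0 x = h x"
| "mixed_nn_int p h (Suc k) x =
     (\<integral>\<^sup>+ t\<in>{-1..1}. ennpowr (mixed_nn_int p h k (x(Suc k := t))) (p (Suc k) / p k) \<partial>lborel)"

lemma mixed_nn_int_Suc:
  "mixed_nn_int p h (Suc k) = (\<lambda>x. \<integral>\<^sup>+ t\<in>{-1..1}.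
     ennpowr (mixed_nn_int p h k (x(Suc k := t))) (p (Suc k) / p k) \<partial>lborel)"
  by (rule ext) simp

text \<open>The innermost exponent \<open>p 1 / 1\<close> is \<open>p 1\<close>, and completing a
  measure does not change the nonnegative integral of any function, so \<open>lebesgue\<close>
  becomes \<open>lborel\<close> for arbitrary \<open>f\<close>.\<close>

lemma mixed_int_eq_mixed_nn_int:
  "mixed_int p f k x = mixed_nn_int (p(0 := 1)) (\<lambda>x. ennreal \<bar>f x\<bar>) k x"
proof (induction k arbitrary: x)
  case (Suc k)
  define p0 where "p0 = p(0 := 1)"
  then have p0: "p0 0 = 1" "p0 (Suc j) = p (Suc j)" for j by auto
  from Suc show ?case
    by (cases k) (simp_all add: p0 nn_integral_completion ennpowr_ennreal flip: p0_def)
qed simp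

lemma measurable_mixed_nn_int:
  assumes "h \<in> borel_measurable (prod_lborel {1..r})" "k \<le> r"
  shows "mixed_nn_int p h k \<in> borel_measurable (prod_lborel {1..r})"
  using assms(2)
proof (induction k)
  case 0
  then show ?case using assms(1) by simp
next
  case (Suc k)
  then have [measurable]: "mixed_nn_int p h k \<in> borel_measurable (prod_lborel {1..r})"
    and [simp]: "Suc k \<le> r" by auto
  show ?case
    unfolding mixed_nn_int_Suc by measurable
qed

text \<open>The first \<open>k\<close> coordinates are overwritten by the iterated integral and are
  therefore left free, which admits the base point \<open>\<lambda>_. undefined\<close> when
  \<open>k = r\<close>.\<close>

definition partial_cube :: "nat \<Rightarrow> nat \<Rightarrow> (nat \<Rightarrow> real) set" where
  "partial_cube r k = {x \<in> {1..r} \<rightarrow>\<^sub>E UNIV. \<forall>i\<in>{Suc k..r}. x i \<in> {-1..1}}"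

lemma partial_cube_0: "partial_cube r 0 = cube r"
  by (auto simp: partial_cube_def cube_def PiE_iff extensional_def)

lemma partial_cube_update:
  assumes "x \<in> partial_cube r (Suc k)" "t \<in> {-1..1}" "Suc k \<le> r"
  shows "x(Suc k := t) \<in> partial_cube r k"
  using assms by (auto simp: partial_cube_def PiE_iff extensional_def)

text \<open>Nonnegative integrals are monotone for arbitrary integrands, so the comparison applies
  directly to \<open>\<bar>f\<bar>\<close>, whose slices may fail to be measurable.\<close>

lemma mixed_nn_int_mono:
  assumes le: "\<And>x. x \<in> cube r \<Longrightarrow> g x \<le> h x"
    and p: "\<And>j. j \<le> r \<Longrightarrow> 0 < p j"
    and "k \<le> r" "x \<in> partial_cube r k"
  shows "mixed_nn_int p g k x \<le> mixed_nn_int p h k x"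
  using assms(3,4)
proof (induction k arbitrary: x)
  case 0
  then show ?case using le by (simp add: partial_cube_0)
next
  case (Suc k)
  have "ennpowr (mixed_nn_int p g k (x(Suc k := t))) (p (Suc k) / p k) * indicator {-1..1} t
      \<le> ennpowr (mixed_nn_int p h k (x(Suc k := t))) (p (Suc k) / p k) * indicator {-1..1} t" for t
    using Suc.prems p[of k] p[of "Suc k"]
    by (cases "t \<in> {-1..1}")
      (auto intro!: ennpowr_mono Suc.IH partial_cube_update)
  then show ?case by (auto intro: nn_integral_mono)
qed

section \<open>Tensor products of averaging kernels\<close>

text \<open>The mass is controlled only for \<open>s\<close> in the interval, where the Kantorovich
  denominator is bounded below. The dual bound is almost everywhere because neighbouring cells share
  endpoints; its indicator keeps the averaged variable in the domain of the mixed norm.\<close>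

locale averaging_kernel =
  fixes \<kappa> :: "real \<Rightarrow> real \<Rightarrow> ennreal" and C :: real
  assumes measurable_case_prod_kernel: "case_prod \<kappa> \<in> borel_measurable (borel \<Otimes>\<^sub>M borel)"
    and kernel_mass: "s \<in> {-1..1} \<Longrightarrow> (\<integral>\<^sup>+ t. \<kappa> s t \<partial>lborel) \<le> 1"
    and kernel_dual: "AE t in lborel. (\<integral>\<^sup>+ s\<in>{-1..1}. \<kappa> s t \<partial>lborel) \<le> ennreal C * indicator {-1..1} t"
    and C_pos: "0 < C"
begin

lemma measurable_kernel [measurable (raw)]:
  assumes [measurable]: "f \<in> borel_measurable M" "g \<in> borel_measurable M"
  shows "(\<lambda>w. \<kappa> (f w) (g w)) \<in> borel_measurable M"
proof -
  have "(\<lambda>w. case_prod \<kappa> (f w, g w)) \<in> borel_measurable M"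
    by (rule measurable_compose[OF _ measurable_case_prod_kernel]) measurable
  then show ?thesis by simp
qed

text \<open>Here \<open>k\<close> counts the coordinates already integrated out:
  \<open>k = 0\<close> is the full tensor product average and \<open>k = r\<close> is the identity
  on points of the product space.\<close>

definition kernel_op ::
    "nat \<Rightarrow> nat \<Rightarrow> ((nat \<Rightarrow> real) \<Rightarrow> ennreal) \<Rightarrow> (nat \<Rightarrow> real) \<Rightarrow> ennreal" where
  "kernel_op r k h x =
     (\<integral>\<^sup>+ y. (\<Prod>i\<in>{Suc k..r}. \<kappa> (x i) (y i)) * h (override r k x y) \<partial>prod_lborel {Suc k..r})"

lemma measurable_kernel_op:
  assumes [measurable]: "h \<in> borel_measurable (prod_lborel {1..r})"
  shows "kernel_op r k h \<in> borel_measurable (prod_lborel {1..r})"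
proof -
  interpret sigma_finite_measure "prod_lborel {Suc k..r}"
    by (rule prod_lborel.sigma_finite) simp
  show ?thesis
    unfolding kernel_op_def[abs_def] by measurable
qed

lemma kernel_op_full:
  assumes "x \<in> {1..r} \<rightarrow>\<^sub>E UNIV"
  shows "kernel_op r r h x = h x"
proof -
  have "override r r x y = x" for y
    using assms by (auto simp: override_def fun_eq_iff PiE_iff extensional_def)
  then show ?thesis
    by (simp add: kernel_op_def PiM_empty nn_integral_count_space_finite)
qed

text \<open>Jensen's inequality for the product kernel. Its mass factors into univariate masses,
  each at most 1 because the coordinates of \<open>x\<close> after \<open>k\<close> lie in the
  interval.\<close>

lemma ennpowr_kernel_op_le:
  assumes h [measurable]: "h \<in> borel_measurable (prod_lborel {1..r})"
    and x: "x \<in> partial_cube r k" and q: "1 \<le> q"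
  shows "ennpowr (kernel_op r k h x) q \<le> kernel_op r k (\<lambda>z. ennpowr (h z) q) x"
  unfolding kernel_op_def
proof (rule ennpowr_nn_integral_le[OF _ _ _ q])
  have [measurable]: "(\<lambda>_. x) \<in> prod_lborel {Suc k..r} \<rightarrow>\<^sub>M prod_lborel {1..r}"
    using x by (auto simp: partial_cube_def space_PiM)
  show "(\<lambda>y. \<Prod>i\<in>{Suc k..r}. \<kappa> (x i) (y i)) \<in> borel_measurable (prod_lborel {Suc k..r})"
    by measurable
  show "(\<lambda>y. h (override r k x y)) \<in> borel_measurable (prod_lborel {Suc k..r})"
    by measurable
  have "(\<integral>\<^sup>+ y. (\<Prod>i\<in>{Suc k..r}. \<kappa> (x i) (y i)) \<partial>prod_lborel {Suc k..r})
      = (\<Prod>i\<in>{Suc k..r}. \<integral>\<^sup>+ t. \<kappa> (x i) t \<partial>lborel)"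
    by (rule prod_lborel.product_nn_integral_prod) auto
  also have "\<dots> \<le> 1"
    using x by (intro prod_le_1) (auto simp: partial_cube_def intro!: kernel_mass)
  finally show "(\<integral>\<^sup>+ y. (\<Prod>i\<in>{Suc k..r}. \<kappa> (x i) (y i)) \<partial>prod_lborel {Suc k..r}) \<le> 1" .
qed

text \<open>By Tonelli the integral over \<open>s\<close> can be carried out first. Only one kernel
  factor depends on \<open>s\<close>, and the dual bound replaces it by \<open>C\<close> and the
  restriction of its other variable to the interval.\<close>

lemma nn_integral_kernel_op_le:
  assumes h [measurable]: "h \<in> borel_measurable (prod_lborel {1..r})"
    and x: "x \<in> {1..r} \<rightarrow>\<^sub>E UNIV" and k: "Suc k \<le> r"
  shows "(\<integral>\<^sup>+ s\<in>{-1..1}. kernel_op r k h (x(Suc k := s)) \<partial>lborel)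
    \<le> ennreal C * kernel_op r (Suc k) (\<lambda>z. \<integral>\<^sup>+ t\<in>{-1..1}. h (z(Suc k := t)) \<partial>lborel) x"
proof -
  let ?I = "{Suc (Suc k)..r}"
  have I: "{Suc k..r} = insert (Suc k) ?I" using k by auto
  have xP: "x \<in> space (prod_lborel {1..r})" using x by (simp add: space_PiM)
  define W where "W y = (\<Prod>i\<in>?I. \<kappa> (x i) (y i))" for y
  have W [measurable]: "W \<in> borel_measurable (prod_lborel ?I)"
    unfolding W_def by (intro borel_measurable_prod_ennreal measurable_kernel) auto
  define H where "H y t = h ((override r (Suc k) x y)(Suc k := t))" for y t
  have H [measurable]: "case_prod H \<in> borel_measurable (prod_lborel ?I \<Otimes>\<^sub>M lborel)"
  proof -
    have "(\<lambda>z. (override r (Suc k) x (fst z))(Suc k := snd z))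
        \<in> prod_lborel ?I \<Otimes>\<^sub>M lborel \<rightarrow>\<^sub>M prod_lborel {1..r}"
      using k xP by (intro measurable_coordinate_update measurable_override measurable_const) auto
    from measurable_compose[OF this h] show ?thesis
      by (simp add: H_def case_prod_beta')
  qed
  define F where "F t = (\<integral>\<^sup>+ y. W y * H y t \<partial>prod_lborel ?I)" for t
  interpret sf: sigma_finite_measure "prod_lborel ?I"
    by (rule prod_lborel.sigma_finite) simp
  have F [measurable]: "F \<in> borel_measurable lborel"
    unfolding F_def by measurable
  \<comment> \<open>Once \<open>t = y (Suc k)\<close> is separated, \<open>s\<close> survives only
    in \<open>\<kappa> s t\<close>, because \<open>override r k\<close> takes coordinate
    \<open>Suc k\<close> from \<open>y\<close>.\<close>
  have peel: "kernel_op r k h (x(Suc k := s)) = (\<integral>\<^sup>+ t. \<kappa> s t * F t \<partial>lborel)" for s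
  proof -
    have prod_eq: "(\<Prod>i\<in>{Suc k..r}. \<kappa> ((x(Suc k := s)) i) ((y(Suc k := t)) i)) = \<kappa> s t * W y" for y t
      unfolding I W_def by (subst prod.insert) (auto intro!: prod.cong)
    have ov: "override r k (x(Suc k := s)) (y(Suc k := t)) = (override r (Suc k) x y)(Suc k := t)" for y t
      using k by (auto simp: override_def fun_eq_iff)
    have meas: "(\<lambda>y. (\<Prod>i\<in>{Suc k..r}. \<kappa> ((x(Suc k := s)) i) (y i)) * h (override r k (x(Suc k := s)) y))
        \<in> borel_measurable (prod_lborel {Suc k..r})"
    proof (intro borel_measurable_times_ennreal borel_measurable_prod_ennreal measurable_kernel)
      have "x(Suc k := s) \<in> space (prod_lborel {1..r})"
        using xP k by (auto simp: space_PiM PiE_iff extensional_def)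
      then have "(\<lambda>y. override r k (x(Suc k := s)) y) \<in> prod_lborel {Suc k..r} \<rightarrow>\<^sub>M prod_lborel {1..r}"
        by (intro measurable_override measurable_const) auto
      from measurable_compose[OF this h]
      show "(\<lambda>y. h (override r k (x(Suc k := s)) y)) \<in> borel_measurable (prod_lborel {Suc k..r})" .
    qed auto
    have "kernel_op r k h (x(Suc k := s)) = (\<integral>\<^sup>+ t. \<integral>\<^sup>+ y.
        (\<Prod>i\<in>{Suc k..r}. \<kappa> ((x(Suc k := s)) i) ((y(Suc k := t)) i))
          * h (override r k (x(Suc k := s)) (y(Suc k := t))) \<partial>prod_lborel ?I \<partial>lborel)"
      unfolding kernel_op_def
      using prod_lborel.product_nn_integral_insert_rev[of ?I "Suc k", OF _ _ meas[unfolded I]]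
      unfolding I by simp
    also have "\<dots> = (\<integral>\<^sup>+ t. \<integral>\<^sup>+ y. \<kappa> s t * (W y * H y t) \<partial>prod_lborel ?I \<partial>lborel)"
      unfolding prod_eq ov H_def by (simp add: mult.assoc)
    also have "\<dots> = (\<integral>\<^sup>+ t. \<kappa> s t * F t \<partial>lborel)"
      unfolding F_def by (intro nn_integral_cong nn_integral_cmult) measurable
    finally show ?thesis .
  qed
  have "(\<integral>\<^sup>+ s\<in>{-1..1}. kernel_op r k h (x(Suc k := s)) \<partial>lborel)
      = (\<integral>\<^sup>+ s. \<integral>\<^sup>+ t. \<kappa> s t * F t * indicator {-1..1} s \<partial>lborel \<partial>lborel)"
    unfolding peel by (intro nn_integral_cong nn_integral_multc[symmetric]) measurable
  also have "\<dots> = (\<integral>\<^sup>+ t. \<integral>\<^sup>+ s. \<kappa> s t * F t * indicator {-1..1} s \<partial>lborel \<partial>lborel)"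
    by (rule lborel_pair.Fubini') measurable
  also have "\<dots> = (\<integral>\<^sup>+ t. (\<integral>\<^sup>+ s\<in>{-1..1}. \<kappa> s t \<partial>lborel) * F t \<partial>lborel)"
    by (intro nn_integral_cong, subst nn_integral_multc[symmetric]) (auto simp: ac_simps)
  also have "\<dots> \<le> (\<integral>\<^sup>+ t. ennreal C * indicator {-1..1} t * F t \<partial>lborel)"
    using kernel_dual by (intro nn_integral_mono_AE, eventually_elim) (rule mult_right_mono, auto)
  also have "\<dots> = ennreal C * (\<integral>\<^sup>+ t. F t * indicator {-1..1} t \<partial>lborel)"
    by (subst nn_integral_cmult[symmetric]) (auto simp: ac_simps)
  \<comment> \<open>Now \<open>t\<close> is the coordinate being integrated out; a second exchange
    moves its integral inside the remaining average.\<close>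
  also have "(\<integral>\<^sup>+ t. F t * indicator {-1..1} t \<partial>lborel)
      = (\<integral>\<^sup>+ t. \<integral>\<^sup>+ y. W y * H y t * indicator {-1..1} t \<partial>prod_lborel ?I \<partial>lborel)"
    unfolding F_def by (intro nn_integral_cong nn_integral_multc[symmetric]) measurable
  also have "\<dots>
      = (\<integral>\<^sup>+ y. \<integral>\<^sup>+ t. W y * H y t * indicator {-1..1} t \<partial>lborel \<partial>prod_lborel ?I)"
    by (rule pair_sigma_finite.Fubini') (unfold_locales, measurable)
  also have "\<dots> = (\<integral>\<^sup>+ y. W y * (\<integral>\<^sup>+ t\<in>{-1..1}. H y t \<partial>lborel) \<partial>prod_lborel ?I)"
    by (intro nn_integral_cong, subst nn_integral_cmult[symmetric]) (auto simp: ac_simps)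
  also have "\<dots> = kernel_op r (Suc k) (\<lambda>z. \<integral>\<^sup>+ t\<in>{-1..1}. h (z(Suc k := t)) \<partial>lborel) x"
    by (simp add: kernel_op_def W_def H_def)
  finally show ?thesis .
qed

text \<open>One step raises the constant to the power \<open>p (Suc k) / p k\<close> by Jensen and
  then multiplies it by \<open>C\<close>. The exponent
  \<open>e k = p k * (\<Sum>i=1..k. 1 / p i)\<close> solves the resulting recursion
  \<open>e (Suc k) = e k * p (Suc k) / p k + 1\<close> with \<open>e 0 = 0\<close>.\<close>

lemma mixed_nn_int_kernel_op_le:
  assumes h [measurable]: "h \<in> borel_measurable (prod_lborel {1..r})"
    and p: "\<And>j. j \<le> r \<Longrightarrow> 0 < p j" "\<And>j. Suc j \<le> r \<Longrightarrow> p j \<le> p (Suc j)"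
    and "k \<le> r" "x \<in> partial_cube r k"
  shows "mixed_nn_int p (kernel_op r 0 h) k x
    \<le> ennreal (C powr (p k * (\<Sum>i=1..k. 1 / p i))) * kernel_op r k (mixed_nn_int p h k) x"
  using assms(4,5)
proof (induction k arbitrary: x)
  case 0
  have "mixed_nn_int p h 0 = h" by (rule ext) simp
  then show ?case using C_pos by simp
next
  case (Suc k)
  let ?q = "p (Suc k) / p k"
  let ?c = "C powr (p k * (\<Sum>i=1..k. 1 / p i))"
  have k: "k \<le> r" "0 < p k" "0 < p (Suc k)" and q: "1 \<le> ?q"
    using Suc.prems p[of k] p(1)[of "Suc k"] by (auto simp: field_simps)
  have x: "x \<in> {1..r} \<rightarrow>\<^sub>E UNIV" using Suc.prems by (simp add: partial_cube_def)
  have M [measurable]: "mixed_nn_int p h k \<in> borel_measurable (prod_lborel {1..r})"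
    by (rule measurable_mixed_nn_int[OF h k(1)])
  let ?N = "\<lambda>z. ennpowr (mixed_nn_int p h k z) ?q"
  have step: "ennpowr (mixed_nn_int p (kernel_op r 0 h) k (x(Suc k := s))) ?q * indicator {-1..1} s
      \<le> ennreal (?c powr ?q) * (kernel_op r k ?N (x(Suc k := s)) * indicator {-1..1} s)" for s
  proof (cases "s \<in> {-1..1}")
    case True
    then have s: "x(Suc k := s) \<in> partial_cube r k"
      using Suc.prems by (intro partial_cube_update)
    have "ennpowr (mixed_nn_int p (kernel_op r 0 h) k (x(Suc k := s))) ?q
        \<le> ennpowr (ennreal ?c * kernel_op r k (mixed_nn_int p h k) (x(Suc k := s))) ?q"
      using q by (intro ennpowr_mono Suc.IH s k) simp
    also have "\<dots> = ennreal (?c powr ?q) * ennpowr (kernel_op r k (mixed_nn_int p h k) (x(Suc k := s))) ?q"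
      using q C_pos by (intro ennpowr_cmult) auto
    also have "\<dots> \<le> ennreal (?c powr ?q) * kernel_op r k ?N (x(Suc k := s))"
      by (intro mult_left_mono ennpowr_kernel_op_le M s q) simp
    finally show ?thesis using True by simp
  qed simp
  have "(\<lambda>s. x(Suc k := s)) \<in> lborel \<rightarrow>\<^sub>M prod_lborel {1..r}"
    using x Suc.prems(1) by (intro measurable_coordinate_update measurable_const) (auto simp: space_PiM)
  moreover have "kernel_op r k ?N \<in> borel_measurable (prod_lborel {1..r})"
    by (rule measurable_kernel_op) measurable
  ultimately have meas: "(\<lambda>s. kernel_op r k ?N (x(Suc k := s))) \<in> borel_measurable lborel"
    by (rule measurable_compose)
  have "mixed_nn_int p (kernel_op r 0 h) (Suc k) x
      \<le> (\<integral>\<^sup>+ s. ennreal (?c powr ?q) * (kernel_op r k ?N (x(Suc k := s)) * indicator {-1..1} s) \<partial>lborel)"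
    unfolding mixed_nn_int.simps by (intro nn_integral_mono step)
  also have "\<dots> = ennreal (?c powr ?q) * (\<integral>\<^sup>+ s\<in>{-1..1}. kernel_op r k ?N (x(Suc k := s)) \<partial>lborel)"
    by (rule nn_integral_cmult) (intro borel_measurable_times_ennreal meas borel_measurable_indicator, simp)
  also have "\<dots> \<le> ennreal (?c powr ?q) * (ennreal C *
      kernel_op r (Suc k) (\<lambda>z. \<integral>\<^sup>+ t\<in>{-1..1}. ?N (z(Suc k := t)) \<partial>lborel) x)"
    by (intro mult_left_mono nn_integral_kernel_op_le measurable_ennpowr M x Suc.prems(1)) simp
  also have "\<dots> = ennreal (?c powr ?q * C) * kernel_op r (Suc k) (mixed_nn_int p h (Suc k)) x"
    unfolding mixed_nn_int_Suc using C_pos by (simp add: ennreal_mult mult.assoc)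
  also have "?c powr ?q * C = C powr (p (Suc k) * (\<Sum>i=1..Suc k. 1 / p i))"
    using C_pos k by (simp add: powr_powr powr_add distrib_left ac_simps)
  finally show ?case .
qed

end

section \<open>The univariate Kantorovich kernel and its two marginal bounds\<close>

definition kant_weight :: "(real \<Rightarrow> real) \<Rightarrow> nat \<Rightarrow> int \<Rightarrow> real \<Rightarrow> real" where
  "kant_weight \<rho> n j s = psi \<rho> (real n * s - real_of_int j)
     / (\<Sum>i\<in>{- int n..int n - 1}. psi \<rho> (real n * s - real_of_int i))"

text \<open>Integral kernel of the one-dimensional operator: integrating it against \<open>f\<close>
  in \<open>t\<close> gives the operator applied to \<open>f\<close> at \<open>s\<close>.\<close>

definition kant_kernel :: "(real \<Rightarrow> real) \<Rightarrow> nat \<Rightarrow> real \<Rightarrow> real \<Rightarrow> real" where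
  "kant_kernel \<rho> n s t = (\<Sum>j\<in>{- int n..int n - 1}.
     kant_weight \<rho> n j s * (real n * indicator {real_of_int j / real n..(real_of_int j + 1) / real n} t))"

lemma psi_nonneg: "0 \<le> psi \<rho> x" if "mono \<rho>"
  using monoD[OF that, of "x - 1" "x + 1"] by (simp add: psi_def)

lemma kant_weight_nonneg: "0 \<le> kant_weight \<rho> n j s" if "mono \<rho>"
  using psi_nonneg[OF that] by (auto simp: kant_weight_def intro!: divide_nonneg_nonneg sum_nonneg)

lemma measurable_psi [measurable (raw)]:
  assumes "mono \<rho>" and [measurable]: "f \<in> borel_measurable M"
  shows "(\<lambda>w. psi \<rho> (f w)) \<in> borel_measurable M"
proof -
  have [measurable]: "\<rho> \<in> borel_measurable borel"
    using assms(1) by (rule borel_measurable_mono)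
  show ?thesis unfolding psi_def by measurable
qed

lemma measurable_kant_weight [measurable (raw)]:
  assumes "mono \<rho>" and [measurable]: "f \<in> borel_measurable M"
  shows "(\<lambda>w. kant_weight \<rho> n j (f w)) \<in> borel_measurable M"
  unfolding kant_weight_def
  by (intro borel_measurable_divide borel_measurable_sum measurable_psi assms(1)) measurable

lemma measurable_kant_kernel:
  assumes "mono \<rho>"
  shows "(\<lambda>(s, t). ennreal (kant_kernel \<rho> n s t)) \<in> borel_measurable (borel \<Otimes>\<^sub>M borel)"
proof -
  have [measurable]: "(\<lambda>w :: real \<times> real. kant_weight \<rho> n j (fst w)) \<in> borel_measurable (borel \<Otimes>\<^sub>M borel)" for j
    by (intro measurable_kant_weight assms) measurable
  show ?thesis
    unfolding kant_kernel_def case_prod_beta by measurable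
qed

lemma ennreal_kant_kernel:
  assumes "mono \<rho>"
  shows "ennreal (kant_kernel \<rho> n s t) = (\<Sum>j\<in>{- int n..int n - 1}. ennreal (kant_weight \<rho> n j s)
     * (ennreal (real n) * indicator {real_of_int j / real n..(real_of_int j + 1) / real n} t))"
  unfolding kant_kernel_def
  by (subst sum_ennreal[symmetric])
    (auto simp: kant_weight_nonneg[OF assms] ennreal_mult ennreal_indicator[symmetric] simp del: ennreal_indicator)

text \<open>The denominator is a product of univariate sums by distributivity, so each multivariate
  weight is a product of normalised univariate ones. Where a factor of the denominator vanishes,
  both sides are 0 by the convention for division.\<close>

lemma kantorovich_eq:
  "kantorovich r \<rho> n f x = (\<Sum>k\<in>kant_index r n.
     (\<Prod>i\<in>{1..r}. kant_weight \<rho> n (k i) (x i)) * real n ^ r * (LINT t:kant_box r n k|leb r. f t))"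
proof -
  have "(\<Sum>k\<in>kant_index r n. psi_multi r \<rho> (\<lambda>j. real n * x j - real_of_int (k j)))
      = (\<Prod>i\<in>{1..r}. \<Sum>j\<in>{- int n..int n - 1}. psi \<rho> (real n * x i - real_of_int j))"
    unfolding kant_index_def psi_multi_def by (rule prod_sum_PiE[symmetric]) auto
  then show ?thesis
    by (simp add: kantorovich_def sum_divide_distrib kant_weight_def psi_multi_def prod_dividef ac_simps)
qed

text \<open>Expanding the product of sums yields one term per multi-index. Extensionality of
  \<open>y\<close> makes the product of cell indicators the indicator of the box.\<close>

lemma prod_kant_kernel_eq:
  assumes y: "y \<in> {1..r} \<rightarrow>\<^sub>E UNIV"
  shows "(\<Prod>i\<in>{1..r}. kant_kernel \<rho> n (x i) (y i)) = (\<Sum>k\<in>kant_index r n.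
     (\<Prod>i\<in>{1..r}. kant_weight \<rho> n (k i) (x i)) * real n ^ r * indicator (kant_box r n k) y)"
proof -
  have box: "(\<Prod>i\<in>{1..r}. indicator {real_of_int (k i) / real n..(real_of_int (k i) + 1) / real n} (y i))
      = (indicator (kant_box r n k) y :: real)" for k
    using y by (auto simp: kant_box_def indicator_def PiE_iff prod_zero_iff)
  show ?thesis
    unfolding kant_kernel_def kant_index_def
    by (simp add: prod_sum_PiE prod.distrib box mult.assoc del: One_nat_def)
qed

context
  fixes \<rho> :: "real \<Rightarrow> real" and n :: nat
  assumes mono: "mono \<rho>" and psi: "psi_assms \<rho>" and n: "1 \<le> n"
begin

lemma psi_2_pos: "0 < psi \<rho> 2"
  using psi by (simp add: psi_assms_def)

text \<open>Identifies the ratio in the theorem with the kernel constant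
  \<open>1 / psi \<rho> 2\<close>.\<close>

lemma L1_norm_psi: "L1_norm (psi \<rho>) = 1"
proof -
  have "L1_norm (psi \<rho>) = (\<integral>t. psi \<rho> t \<partial>lborel)"
    using psi_nonneg[OF mono] by (simp add: L1_norm_def)
  then show ?thesis
    using psi by (simp add: psi_assms_def has_bochner_integral_integral_eq)
qed

lemma sum_psi_ge:
  assumes "s \<in> {-1..1}"
  shows "psi \<rho> 2 \<le> (\<Sum>i\<in>{- int n..int n - 1}. psi \<rho> (real n * s - real_of_int i))"
  using psi n assms unfolding psi_assms_def by blast

lemma sum_kant_weight:
  assumes "s \<in> {-1..1}"
  shows "(\<Sum>j\<in>{- int n..int n - 1}. kant_weight \<rho> n j s) = 1"
  using sum_psi_ge[OF assms] psi_2_pos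
  by (simp add: kant_weight_def flip: sum_divide_distrib)

lemma kant_weight_le:
  assumes "s \<in> {-1..1}"
  shows "kant_weight \<rho> n j s \<le> psi \<rho> (real n * s - real_of_int j) / psi \<rho> 2"
  unfolding kant_weight_def
  using sum_psi_ge[OF assms] psi_2_pos psi_nonneg[OF mono] by (intro divide_left_mono) auto

text \<open>The denominator is at least \<open>psi \<rho> 2\<close>, and the numerator may be
  integrated over the whole line. The factor \<open>n\<close> is the Jacobian of the substitution
  \<open>u = - j + n * s\<close>, which leaves the total integral 1 of the density.\<close>

lemma nn_integral_kant_weight_le:
  "(\<integral>\<^sup>+ s\<in>{-1..1}. ennreal (kant_weight \<rho> n j s) \<partial>lborel) * ennreal (real n) \<le> ennreal (1 / psi \<rho> 2)"
proof -
  have [measurable]: "psi \<rho> \<in> borel_measurable borel"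
    by (rule measurable_psi[OF mono]) simp
  have "(\<integral>\<^sup>+ s\<in>{-1..1}. ennreal (kant_weight \<rho> n j s) \<partial>lborel)
      \<le> (\<integral>\<^sup>+ s. ennreal (1 / psi \<rho> 2) * ennreal (psi \<rho> (- real_of_int j + real n * s)) \<partial>lborel)"
  proof (rule nn_integral_mono)
    fix s :: real
    show "ennreal (kant_weight \<rho> n j s) * indicator {-1..1} s
        \<le> ennreal (1 / psi \<rho> 2) * ennreal (psi \<rho> (- real_of_int j + real n * s))"
    proof (cases "s \<in> {-1..1}")
      case True
      from kant_weight_le[OF this, of j] True psi_2_pos show ?thesis
        by (auto simp flip: ennreal_mult' intro!: ennreal_leI)
    qed simp
  qed
  also have "\<dots> = ennreal (1 / psi \<rho> 2) * (\<integral>\<^sup>+ s. ennreal (psi \<rho> (- real_of_int j + real n * s)) \<partial>lborel)"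
    by (rule nn_integral_cmult) measurable
  finally have "(\<integral>\<^sup>+ s\<in>{-1..1}. ennreal (kant_weight \<rho> n j s) \<partial>lborel)
      \<le> ennreal (1 / psi \<rho> 2) * (\<integral>\<^sup>+ s. ennreal (psi \<rho> (- real_of_int j + real n * s)) \<partial>lborel)" .
  from mult_right_mono[OF this, of "ennreal (real n)"]
  have "(\<integral>\<^sup>+ s\<in>{-1..1}. ennreal (kant_weight \<rho> n j s) \<partial>lborel) * ennreal (real n)
      \<le> ennreal (1 / psi \<rho> 2) * (ennreal \<bar>real n\<bar> * (\<integral>\<^sup>+ s. ennreal (psi \<rho> (- real_of_int j + real n * s)) \<partial>lborel))"
    by (simp add: ac_simps)
  also have "ennreal \<bar>real n\<bar> * (\<integral>\<^sup>+ s. ennreal (psi \<rho> (- real_of_int j + real n * s)) \<partial>lborel)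
      = (\<integral>\<^sup>+ s. ennreal (psi \<rho> s) \<partial>lborel)"
    using n by (intro nn_integral_real_affine[symmetric]) auto
  also have "\<dots> = 1"
    using psi psi_nonneg[OF mono]
    by (auto simp: psi_assms_def nn_integral_eq_integral has_bochner_integral_iff)
  finally show ?thesis by simp
qed

text \<open>Each cell has length \<open>1 / n\<close>, cancelling the factor \<open>n\<close>, and
  the weights sum to 1.\<close>

lemma nn_integral_kant_kernel:
  assumes "s \<in> {-1..1}"
  shows "(\<integral>\<^sup>+ t. ennreal (kant_kernel \<rho> n s t) \<partial>lborel) = 1"
proof -
  have "(\<integral>\<^sup>+ t. ennreal (kant_kernel \<rho> n s t) \<partial>lborel)
      = (\<Sum>j\<in>{- int n..int n - 1}. ennreal (kant_weight \<rho> n j s) * (ennreal (real n)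
          * emeasure lborel {real_of_int j / real n..(real_of_int j + 1) / real n}))"
    unfolding ennreal_kant_kernel[OF mono]
    by (simp add: nn_integral_sum nn_integral_cmult nn_integral_cmult_indicator)
  also have "\<dots> = (\<Sum>j\<in>{- int n..int n - 1}. ennreal (kant_weight \<rho> n j s))"
  proof (rule sum.cong)
    fix j :: int
    have "(real_of_int j + 1) / real n - real_of_int j / real n = 1 / real n"
      by (simp add: diff_divide_distrib[symmetric])
    then have "emeasure lborel {real_of_int j / real n..(real_of_int j + 1) / real n} = ennreal (1 / real n)"
      by (simp add: divide_right_mono)
    then show "ennreal (kant_weight \<rho> n j s) * (ennreal (real n)
        * emeasure lborel {real_of_int j / real n..(real_of_int j + 1) / real n}) = ennreal (kant_weight \<rho> n j s)"
      using n by (simp flip: ennreal_mult)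
  qed simp
  also have "\<dots> = ennreal (\<Sum>j\<in>{- int n..int n - 1}. kant_weight \<rho> n j s)"
    by (rule sum_ennreal) (rule kant_weight_nonneg[OF mono])
  finally show ?thesis by (simp add: sum_kant_weight[OF assms])
qed

text \<open>Off the grid, the only cell that can contain \<open>t\<close> has index
  \<open>\<lfloor>real n * t\<rfloor>\<close>, so the cells do not overlap there.\<close>

lemma sum_indicator_grid_le:
  assumes t: "t \<notin> (\<lambda>j. real_of_int j / real n) ` {- int n..int n}"
  shows "(\<Sum>j\<in>{- int n..int n - 1}. indicator {real_of_int j / real n..(real_of_int j + 1) / real n} t)
    \<le> (indicator {-1..1} t :: ennreal)"
proof -
  have eq: "indicator {real_of_int j / real n..(real_of_int j + 1) / real n} t
      = (if j = \<lfloor>real n * t\<rfloor> then indicator {-1..1} t else 0 :: ennreal)"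
    if j: "j \<in> {- int n..int n - 1}" for j
  proof -
    have in_iff: "t \<in> {real_of_int j / real n..(real_of_int j + 1) / real n}
        \<longleftrightarrow> real_of_int j \<le> real n * t \<and> real n * t \<le> real_of_int j + 1"
      using n by (auto simp: field_simps)
    \<comment> \<open>Excludes the right endpoint of the cell. Since \<open>j + 1\<close> can equal
      \<open>n\<close>, the excluded grid runs up to \<open>n\<close> although the cell indices stop
      at \<open>n - 1\<close>.\<close>
    have ne: "real n * t \<noteq> real_of_int j + 1"
    proof
      assume "real n * t = real_of_int j + 1"
      then have "t = real_of_int (j + 1) / real n" using n by (simp add: field_simps)
      moreover have "j + 1 \<in> {- int n..int n}" using j by auto
      ultimately show False using t by blast
    qed
    show ?thesis
    proof (cases "t \<in> {real_of_int j / real n..(real_of_int j + 1) / real n}")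
      case True
      have "- real n \<le> real_of_int j" "real_of_int j + 1 \<le> real n" using j by auto
      moreover have "real_of_int j \<le> real n * t" "real n * t \<le> real_of_int j + 1"
        using True in_iff by auto
      ultimately have "real n * (-1) \<le> real n * t" "real n * t \<le> real n * 1" by linarith+
      then have "t \<in> {-1..1}" using n by (simp only: mult_le_cancel_left_pos) simp
      moreover have "\<lfloor>real n * t\<rfloor> = j"
        using True in_iff ne by (simp add: floor_eq_iff)
      ultimately show ?thesis using True by simp
    next
      case False
      have "\<lfloor>real n * t\<rfloor> \<noteq> j"
        using False unfolding in_iff floor_eq_iff by auto
      with False show ?thesis by simp
    qed
  qed
  have "(\<Sum>j\<in>{- int n..int n - 1}. indicator {real_of_int j / real n..(real_of_int j + 1) / real n} t)
      = (\<Sum>j\<in>{- int n..int n - 1}. if j = \<lfloor>real n * t\<rfloor> then indicator {-1..1} t else 0 :: ennreal)"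
    by (intro sum.cong eq refl)
  then show ?thesis
    by (simp only: sum.delta' sum.delta finite_atLeastAtMost_int) simp
qed

text \<open>Every cell contributes at most \<open>1 / psi \<rho> 2\<close> times its indicator, and
  away from the finite, hence null, set of grid points these indicators add up to at most that of
  the interval.\<close>

lemma kant_kernel_dual:
  "AE t in lborel. (\<integral>\<^sup>+ s\<in>{-1..1}. ennreal (kant_kernel \<rho> n s t) \<partial>lborel)
    \<le> ennreal (1 / psi \<rho> 2) * indicator {-1..1} t"
proof -
  have "AE t in lborel. t \<notin> (\<lambda>j. real_of_int j / real n) ` {- int n..int n}"
    by (intro AE_not_in finite_imp_null_set_lborel) simp
  then show ?thesis
  proof eventually_elim
    case (elim t)
    let ?w = "\<lambda>j s. ennreal (kant_weight \<rho> n j s) * indicator {-1..1} s"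
    let ?i = "\<lambda>j. indicator {real_of_int j / real n..(real_of_int j + 1) / real n} t :: ennreal"
    have [measurable]: "(\<lambda>s. kant_weight \<rho> n j s) \<in> borel_measurable borel" for j
      by (rule measurable_kant_weight[OF mono]) simp
    have "(\<integral>\<^sup>+ s\<in>{-1..1}. ennreal (kant_kernel \<rho> n s t) \<partial>lborel)
        = (\<integral>\<^sup>+ s. (\<Sum>j\<in>{- int n..int n - 1}. ?w j s * (ennreal (real n) * ?i j)) \<partial>lborel)"
      unfolding ennreal_kant_kernel[OF mono]
      by (simp add: sum_distrib_left sum_distrib_right ac_simps)
    also have "\<dots> = (\<Sum>j\<in>{- int n..int n - 1}. integral\<^sup>N lborel (?w j) * (ennreal (real n) * ?i j))"
      by (simp add: nn_integral_sum nn_integral_multc)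
    also have "\<dots> \<le> (\<Sum>j\<in>{- int n..int n - 1}. ennreal (1 / psi \<rho> 2) * ?i j)"
      unfolding mult.assoc[symmetric]
      by (intro sum_mono mult_right_mono nn_integral_kant_weight_le) simp
    also have "\<dots> \<le> ennreal (1 / psi \<rho> 2) * indicator {-1..1} t"
      unfolding sum_distrib_left[symmetric]
      by (intro mult_left_mono sum_indicator_grid_le elim) simp
    finally show ?case .
  qed
qed

lemma averaging_kernel_kant_kernel:
  "averaging_kernel (\<lambda>s t. ennreal (kant_kernel \<rho> n s t)) (1 / psi \<rho> 2)"
  by unfold_locales
    (use measurable_kant_kernel[OF mono] nn_integral_kant_kernel kant_kernel_dual psi_2_pos in
      \<open>simp_all add: case_prod_beta\<close>)

end

section \<open>Passage to Borel functions and the norm estimate\<close>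

text \<open>If \<open>f\<close> is not integrable on \<open>A\<close>, the left side is 0 by the
  convention for the Bochner integral.\<close>

lemma ennreal_abs_set_integral_le:
  fixes f :: "'a \<Rightarrow> real"
  shows "ennreal \<bar>LINT t:A|M. f t\<bar> \<le> (\<integral>\<^sup>+ t. ennreal \<bar>f t\<bar> * indicator A t \<partial>M)"
proof (cases "set_integrable M A f")
  case True
  then have "ennreal \<bar>LINT t:A|M. f t\<bar> \<le> (\<integral>\<^sup>+ t. ennreal \<bar>indicator A t * f t\<bar> \<partial>M)"
    using integral_norm_bound_ennreal[of M "\<lambda>t. indicator A t *\<^sub>R f t"]
    by (simp add: set_lebesgue_integral_def set_integrable_def)
  also have "\<dots> = (\<integral>\<^sup>+ t. ennreal \<bar>f t\<bar> * indicator A t \<partial>M)"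
    by (intro nn_integral_cong) (auto simp: indicator_def)
  finally show ?thesis .
qed (simp add: set_lebesgue_integral_def set_integrable_def not_integrable_integral_eq)

text \<open>
  The bound on \<open>A\<close> holds everywhere, so it passes through iterated integrals without any argument
  about null sets of slices.
\<close>

lemma borel_minorant:
  fixes f :: "'a \<Rightarrow> real"
  assumes "A \<in> sets M" "f \<in> borel_measurable (restrict_space (completion M) A)"
  obtains h :: "'a \<Rightarrow> ennreal"
  where "h \<in> borel_measurable M"
    "\<And>x. x \<in> A \<Longrightarrow> h x \<le> ennreal \<bar>f x\<bar>" "AE x in M. x \<in> A \<longrightarrow> h x = ennreal \<bar>f x\<bar>"
proof -
  have "(\<lambda>x. indicator A x *\<^sub>R f x) \<in> borel_measurable (completion M)"
    using assms sets.sets_into_space[OF assms(1)]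
    by (subst borel_measurable_restrict_space_iff[symmetric]) (auto simp: Int_absorb2)
  from completion_ex_borel_measurable_real[OF this]
  obtain g where g [measurable]: "g \<in> borel_measurable M"
    and ae: "AE x in M. indicator A x *\<^sub>R f x = g x"
    by blast
  from AE_E3[OF ae] obtain N where N: "\<And>x. x \<in> space M - N \<Longrightarrow> indicator A x *\<^sub>R f x = g x"
    "N \<in> null_sets M" by blast
  have [measurable]: "N \<in> sets M" using N(2) by (rule null_setsD2)
  \<comment> \<open>Setting the Borel version to 0 on the exceptional null set turns almost
    everywhere equality into a bound at every point of \<open>A\<close>.\<close>
  let ?h = "\<lambda>x. ennreal \<bar>g x\<bar> * indicator (space M - N) x"
  show ?thesis
  proof
    show "?h \<in> borel_measurable M" by measurable
    show "?h x \<le> ennreal \<bar>f x\<bar>" if "x \<in> A" for x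
      using that N(1)[of x] by (auto simp: indicator_def)
    show "AE x in M. x \<in> A \<longrightarrow> ?h x = ennreal \<bar>f x\<bar>"
      using AE_not_in[OF N(2)] AE_space by eventually_elim (use N(1) in force)
  qed
qed

lemma kant_box_subset_cube:
  assumes "1 \<le> n" "k \<in> kant_index r n"
  shows "kant_box r n k \<subseteq> cube r"
proof -
  have "{real_of_int j / real n..(real_of_int j + 1) / real n} \<subseteq> {-1..1}"
    if "j \<in> {- int n..int n - 1}" for j
  proof -
    have "- real n \<le> real_of_int j" "real_of_int j + 1 \<le> real n" using that by auto
    then show ?thesis using assms(1) by (auto simp: field_simps intro: order_trans)
  qed
  with assms(2) show ?thesis
    unfolding kant_box_def cube_def kant_index_def by (intro PiE_mono) (auto dest!: PiE_mem)
qed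

theorem theorem3p1:
  fixes r n :: nat and p :: "nat \<Rightarrow> real" and \<rho> :: "real \<Rightarrow> real"
    and f :: "(nat \<Rightarrow> real) \<Rightarrow> real"
  assumes "mono \<rho>" and "sigmoidal \<rho>" and "psi_assms \<rho>"
    and "r \<ge> 1" and "1 \<le> p 1" and "mono_on {1..r} p"
    and "f \<in> mixed_Lebesgue r p"
    and "n \<ge> 1"
  shows "mixed_norm r p (kantorovich r \<rho> n f)
    \<le> ennreal ((L1_norm (psi \<rho>) / psi \<rho> 2) powr (\<Sum>i=1..r. 1 / p i)) * mixed_norm r p f"
proof -
  note psi = assms(1,3,8)
  let ?C = "1 / psi \<rho> 2"
  interpret averaging_kernel "\<lambda>s t. ennreal (kant_kernel \<rho> n s t)" ?C
    by (rule averaging_kernel_kant_kernel[OF psi])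
  have box [measurable]: "kant_box r n k \<in> sets (prod_lborel {1..r})" for k
    unfolding kant_box_def by (intro sets_PiM_I_finite) auto
  have "cube r \<in> sets (prod_lborel {1..r})"
    unfolding cube_def by (intro sets_PiM_I_finite) auto
  moreover have "f \<in> borel_measurable (restrict_space (completion (prod_lborel {1..r})) (cube r))"
    using assms(7) by (simp add: mixed_Lebesgue_def leb_def)
  ultimately obtain h where h [measurable]: "h \<in> borel_measurable (prod_lborel {1..r})"
    and h_le: "\<And>x. x \<in> cube r \<Longrightarrow> h x \<le> ennreal \<bar>f x\<bar>"
    and h_eq: "AE x in prod_lborel {1..r}. x \<in> cube r \<longrightarrow> h x = ennreal \<bar>f x\<bar>"
    using borel_minorant by blast

  \<comment> \<open>The operator sees \<open>f\<close> only through integrals over boxes, so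
    \<open>\<bar>f\<bar>\<close> may be replaced by its Borel minorant \<open>h\<close> without
    loss.\<close>
  have kant_le: "ennreal \<bar>kantorovich r \<rho> n f x\<bar> \<le> kernel_op r 0 h x" for x
  proof -
    let ?W = "\<lambda>k. (\<Prod>i\<in>{1..r}. kant_weight \<rho> n (k i) (x i)) * real n ^ r"
    have W: "0 \<le> ?W k" for k
      by (intro mult_nonneg_nonneg prod_nonneg kant_weight_nonneg psi) auto
    have abs_W: "\<bar>?W k * c\<bar> = ?W k * \<bar>c\<bar>" for k c
      unfolding abs_mult[of "?W k" c] abs_of_nonneg[OF W] ..
    have integral_le: "ennreal \<bar>LINT t:kant_box r n k|leb r. f t\<bar>
        \<le> (\<integral>\<^sup>+ y. h y * indicator (kant_box r n k) y \<partial>prod_lborel {1..r})" if "k \<in> kant_index r n" for k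
    proof -
      have "ennreal \<bar>LINT t:kant_box r n k|leb r. f t\<bar>
          \<le> (\<integral>\<^sup>+ y. ennreal \<bar>f y\<bar> * indicator (kant_box r n k) y \<partial>leb r)"
        by (rule ennreal_abs_set_integral_le)
      also have "\<dots> = (\<integral>\<^sup>+ y. ennreal \<bar>f y\<bar> * indicator (kant_box r n k) y \<partial>prod_lborel {1..r})"
        by (simp add: leb_def nn_integral_completion)
      also have "\<dots> = (\<integral>\<^sup>+ y. h y * indicator (kant_box r n k) y \<partial>prod_lborel {1..r})"
      \<comment> \<open>The boxes lie inside the cube, where \<open>h\<close> and
        \<open>\<bar>f\<bar>\<close> agree almost everywhere.\<close>
      proof (rule nn_integral_cong_AE)
        from h_eq show "AE y in prod_lborel {1..r}. ennreal \<bar>f y\<bar> * indicator (kant_box r n k) y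
            = h y * indicator (kant_box r n k) y"
          by eventually_elim (use kant_box_subset_cube[OF psi(3) that] in \<open>auto simp: indicator_def\<close>)
      qed
      finally show ?thesis by simp
    qed
    have "ennreal \<bar>kantorovich r \<rho> n f x\<bar>
        \<le> ennreal (\<Sum>k\<in>kant_index r n. ?W k * \<bar>LINT t:kant_box r n k|leb r. f t\<bar>)"
      unfolding kantorovich_eq
      by (intro ennreal_leI order_trans[OF sum_abs] sum_mono) (simp only: abs_W order_refl)
    also have "\<dots> = (\<Sum>k\<in>kant_index r n. ennreal (?W k) * ennreal \<bar>LINT t:kant_box r n k|leb r. f t\<bar>)"
      using W by (simp add: ennreal_mult flip: sum_ennreal)
    also have "\<dots> \<le> (\<Sum>k\<in>kant_index r n. ennreal (?W k)
        * (\<integral>\<^sup>+ y. h y * indicator (kant_box r n k) y \<partial>prod_lborel {1..r}))"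
      by (intro sum_mono mult_left_mono integral_le) auto
    also have "\<dots> = (\<Sum>k\<in>kant_index r n.
        (\<integral>\<^sup>+ y. ennreal (?W k) * (h y * indicator (kant_box r n k) y) \<partial>prod_lborel {1..r}))"
      by (intro sum.cong refl nn_integral_cmult[symmetric]) measurable
    also have "\<dots> = (\<integral>\<^sup>+ y. (\<Sum>k\<in>kant_index r n. ennreal (?W k) * (h y * indicator (kant_box r n k) y))
        \<partial>prod_lborel {1..r})"
      by (rule nn_integral_sum[symmetric]) measurable
    \<comment> \<open>The weighted sum of box indicators is the multi-index expansion of the product
      kernel.\<close>
    also have "\<dots> = kernel_op r 0 h x"
      unfolding kernel_op_def One_nat_def[symmetric]
    proof (rule nn_integral_cong)
      fix y :: "nat \<Rightarrow> real" assume "y \<in> space (prod_lborel {1..r})"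
      then have y: "y \<in> {1..r} \<rightarrow>\<^sub>E UNIV" by (simp add: space_PiM)
      then have "override r 0 x y = y"
        by (auto simp: override_def fun_eq_iff PiE_iff extensional_def)
      moreover have "(\<Prod>i\<in>{1..r}. ennreal (kant_kernel \<rho> n (x i) (y i)))
          = ennreal (\<Sum>k\<in>kant_index r n. ?W k * indicator (kant_box r n k) y)"
        unfolding prod_kant_kernel_eq[OF y, symmetric]
        by (rule prod_ennreal) (auto simp: kant_kernel_def intro!: sum_nonneg mult_nonneg_nonneg kant_weight_nonneg psi)
      moreover have "\<dots> = (\<Sum>k\<in>kant_index r n. ennreal (?W k) * indicator (kant_box r n k) y)"
        using W by (simp add: ennreal_mult flip: sum_ennreal ennreal_indicator)
      ultimately show "(\<Sum>k\<in>kant_index r n. ennreal (?W k) * (h y * indicator (kant_box r n k) y))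
          = (\<Prod>i\<in>{1..r}. ennreal (kant_kernel \<rho> n (x i) (y i))) * h (override r 0 x y)"
        by (simp add: sum_distrib_left ac_simps)
    qed
    finally show ?thesis .
  qed

  define p0 where "p0 = p(0 := 1)"
  have p_ge_1: "1 \<le> p j" if "j \<in> {1..r}" for j
    using mono_onD[OF assms(6), of 1 j] that assms(5) by auto
  have p_pos: "0 < p0 j" if "j \<le> r" for j
    using that p_ge_1[of j] by (cases j) (auto simp: p0_def)
  \<comment> \<open>The case \<open>j = 0\<close> compares \<open>p0 0 = 1\<close> with
    \<open>p 1\<close>; it makes the first Jensen exponent at least 1.\<close>
  have p_mono: "p0 j \<le> p0 (Suc j)" if "Suc j \<le> r" for j
    using that assms(5) mono_onD[OF assms(6), of j "Suc j"] by (cases j) (auto simp: p0_def)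
  have base: "(\<lambda>_. undefined) \<in> partial_cube r r"
    by (auto simp: partial_cube_def)
  let ?S = "\<Sum>i=1..r. 1 / p i"
  have pr: "p0 r = p r" using assms(4) by (auto simp: p0_def)
  have sum_p0: "(\<Sum>i=1..r. 1 / p0 i) = ?S"
    by (intro sum.cong) (auto simp: p0_def)
  have full: "kernel_op r r (mixed_nn_int p0 h r) (\<lambda>_. undefined) = mixed_nn_int p0 h r (\<lambda>_. undefined)"
    using base by (intro kernel_op_full) (simp add: partial_cube_def)
  have "mixed_int p (kantorovich r \<rho> n f) r (\<lambda>_. undefined)
      \<le> mixed_nn_int p0 (kernel_op r 0 h) r (\<lambda>_. undefined)"
    unfolding mixed_int_eq_mixed_nn_int p0_def[symmetric]
    by (rule mixed_nn_int_mono[where r=r and p=p0 and k=r, OF kant_le p_pos order_refl base])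
  also have "\<dots> \<le> ennreal (?C powr (p0 r * (\<Sum>i=1..r. 1 / p0 i)))
      * kernel_op r r (mixed_nn_int p0 h r) (\<lambda>_. undefined)"
    by (rule mixed_nn_int_kernel_op_le[where r=r and p=p0 and k=r, OF h p_pos p_mono order_refl base])
  also have "\<dots> = ennreal (?C powr (p r * ?S)) * mixed_nn_int p0 h r (\<lambda>_. undefined)"
    unfolding sum_p0 full pr ..
  \<comment> \<open>The pointwise bound \<open>h \<le> \<bar>f\<bar>\<close> on the cube returns
    from the minorant to \<open>f\<close>.\<close>
  also have "\<dots> \<le> ennreal (?C powr (p r * ?S)) * mixed_int p f r (\<lambda>_. undefined)"
    unfolding mixed_int_eq_mixed_nn_int p0_def[symmetric]
    by (rule mult_left_mono[OF mixed_nn_int_mono[where r=r and p=p0 and k=r, OF h_le p_pos order_refl base] zero_le])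
  finally have main: "mixed_int p (kantorovich r \<rho> n f) r (\<lambda>_. undefined)
      \<le> ennreal (?C powr (p r * ?S)) * mixed_int p f r (\<lambda>_. undefined)" .
  have "0 < p r" using p_pos[of r] pr by simp
  have "mixed_norm r p (kantorovich r \<rho> n f)
      \<le> ennpowr (ennreal (?C powr (p r * ?S)) * mixed_int p f r (\<lambda>_. undefined)) (1 / p r)"
    unfolding mixed_norm_def using \<open>0 < p r\<close> by (intro ennpowr_mono main) simp
  also have "\<dots> = ennreal ((?C powr (p r * ?S)) powr (1 / p r)) * mixed_norm r p f"
    unfolding mixed_norm_def using \<open>0 < p r\<close> psi_2_pos[OF psi] by (intro ennpowr_cmult) auto
  \<comment> \<open>The outer root cancels the factor \<open>p r\<close> in the exponent.\<close>
  also have "(?C powr (p r * ?S)) powr (1 / p r) = ?C powr ?S"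
    using \<open>0 < p r\<close> by (simp add: powr_powr)
  finally show ?thesis
    by (simp add: L1_norm_psi[OF psi])
qed

end
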